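(* Let $q$ be a prime power, $\mathbb{F}_q$ the field with $q$ elements, and $m_3,m_5,m_6$ positive integers. Let $K_E\in\mathbb{F}_q^{m_6\times m_3}$, $H_E\in\mathbb{F}_q^{m_6\times m_5}$ be fixed matrices, and let $\alpha=(\alpha_1,\dots,\alpha_{m_5}):\mathbb{F}_q^{m_6}\to\mathbb{F}_q^{m_5}$ be a function (Eve's strategy) satisfying the uniqueness condition: for every $\mathbf{x}\in\mathbb{F}_q^{m_3}$ there exists a unique $\mathbf{y}\in\mathbb{F}_q^{m_6}$ with $\mathbf{y}=K_E\mathbf{x}+H_E\,\alpha(\mathbf{y})$. Let $\mathbf{X}$ be a random variable with values in $\mathbb{F}_q^{m_3}$ (Alice's input), let $\mathbf{Y}_E(\alpha)$ be Eve's information with strategy $\alpha$, and let $\mathbf{Y}_E(0)$ be Eve's information with strategy $0$ (the passive attack). Then $\mathbf{Y}_E(\alpha)$ can be calculated from $\mathbf{Y}_E(0)$ and, conversely, $\mathbf{Y}_E(0)$ can be calculated from $\mathbf{Y}_E(\alpha)$; that is, there are maps $f,g:\mathbb{F}_q^{m_6}\to\mathbb{F}_q^{m_6}$, depending only on $K_E,H_E,\alpha$, such that $\mathbf{Y}_E(\alpha)=f(\mathbf{Y}_E(0))$ and $\mathbf{Y}_E(0)=g(\mathbf{Y}_E(\alpha))$. Hence $$I(\mathbf{X};\mathbf{Y}_E)[0]=I(\mathbf{X};\mathbf{Y}_E)[\alpha].$$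
   Context: Wiretap and addition model (single transmission): Alice inputs $\mathbf{X}\in\mathbb{F}_q^{m_3}$, Eve injects noise $\mathbf{Z}\in\mathbb{F}_q^{m_5}$ and observes $\mathbf{Y}_E=K_E\mathbf{X}+H_E\mathbf{Z}\in\mathbb{F}_q^{m_6}$. (Bob receives $\mathbf{Y}_B=K_B\mathbf{X}+H_B\mathbf{Z}$ for further matrices $K_B,H_B$, which play no role here.) An active attack with strategy $\alpha=[\alpha_i]_{1\le i\le m_5}$ means that the $i$-th component of $\mathbf{Z}$ is $Z_i=\alpha_i(\mathbf{Y}_E)$. Thus, under the uniqueness condition, $\mathbf{Y}_E(\alpha)$ is the unique random vector satisfying $\mathbf{Y}_E(\alpha)=K_E\mathbf{X}+H_E\,\alpha(\mathbf{Y}_E(\alpha))$. Strategy $0$ is the constant zero function, so $\mathbf{Y}_E(0)=K_E\mathbf{X}$. $I(\mathbf{X};\mathbf{Y}_E)[\alpha]$ denotes the mutual information between $\mathbf{X}$ and $\mathbf{Y}_E(\alpha)$. *)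

theory Defs
  imports "HOL-Analysis.Analysis" "HOL-Probability.Probability"
begin

text \<open>
  The field with \<open>q\<close> elements is a type \<open>'a::{field,finite}\<close>, so \<open>q = CARD('a)\<close>; the lengths
  \<open>m\<^sub>3\<close>, \<open>m\<^sub>5\<close>, \<open>m\<^sub>6\<close> are the cardinalities of the index types.
\<close>

definition uniqueness_condition ::
  "'a::{field,finite}^'m3^'m6 \<Rightarrow> 'a^'m5^'m6 \<Rightarrow> ('a^'m6 \<Rightarrow> 'a^'m5) \<Rightarrow> bool" where
  "uniqueness_condition K_E H_E \<alpha> \<longleftrightarrow> (\<forall>x. \<exists>!y. y = K_E *v x + H_E *v \<alpha> y)"

definition Y_E ::
  "'a::{field,finite}^'m3^'m6 \<Rightarrow> 'a^'m5^'m6 \<Rightarrow> ('a^'m6 \<Rightarrow> 'a^'m5) \<Rightarrow>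
   ('w \<Rightarrow> 'a^'m3) \<Rightarrow> 'w \<Rightarrow> 'a^'m6" where
  "Y_E K_E H_E \<alpha> X \<omega> = (THE y. y = K_E *v X \<omega> + H_E *v \<alpha> y)"

abbreviation zero_strategy :: "'a::{field,finite}^'m6 \<Rightarrow> 'a^'m5" where
  "zero_strategy \<equiv> (\<lambda>_. 0)"

definition eve_mutual_information ::
  "'w measure \<Rightarrow> real \<Rightarrow> 'a::{field,finite}^'m3^'m6 \<Rightarrow> 'a^'m5^'m6 \<Rightarrow> ('w \<Rightarrow> 'a^'m3) \<Rightarrow>
   ('a^'m6 \<Rightarrow> 'a^'m5) \<Rightarrow> real" where
  "eve_mutual_information M b K_E H_E X \<alpha> =
     prob_space.mutual_information M b (count_space UNIV) (count_space UNIV) X (Y_E K_E H_E \<alpha> X)"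

lemma Y_E_eqI:
  assumes "uniqueness_condition K_E H_E \<alpha>"
    and "y = K_E *v X \<omega> + H_E *v \<alpha> y"
  shows "Y_E K_E H_E \<alpha> X \<omega> = y"
  unfolding Y_E_def
  using assms unfolding uniqueness_condition_def by (intro the1_equality) auto

lemma Y_E_fixpoint:
  assumes "uniqueness_condition K_E H_E \<alpha>"
  shows "Y_E K_E H_E \<alpha> X \<omega> = K_E *v X \<omega> + H_E *v \<alpha> (Y_E K_E H_E \<alpha> X \<omega>)"
proof -
  have "\<exists>!y. y = K_E *v X \<omega> + H_E *v \<alpha> y"
    using assms by (simp add: uniqueness_condition_def)
  from theI'[OF this] show ?thesis
    unfolding Y_E_def .
qed

lemma Y_E_zero: "Y_E K_E H_E zero_strategy X \<omega> = K_E *v X \<omega>"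
  by (simp add: Y_E_def)

end

theory Submission
  imports Defs
begin

text \<open>The equation y = K_E x + H_E \<alpha>(y) involves x only through u = K_E x, which is
  what Eve sees under strategy 0. Its solution is therefore a function f(u), and solving for u
  instead gives g(y) = y - H_E \<alpha>(y). Hence g undoes f on all values that the passive
  observation takes, and the active observation is an injective relabelling of the passive one. Such
  a relabelling preserves mutual information (\<open>mutual_information_inj_finite\<close>): in the
  finite sum for it (\<open>mutual_information_count_space_finite\<close>) it only renames the index
  y.\<close>

lemma (in prob_space) distributed_count_space_finite:
  fixes X :: "'a \<Rightarrow> 'b::finite"
  assumes "random_variable (count_space UNIV) X"
  shows "distributed M (count_space UNIV) X (\<lambda>x. ennreal (prob (X -` {x} \<inter> space M)))"
  unfolding distributed_def
proof (intro conjI)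
  show "distr M (count_space UNIV) X
      = density (count_space UNIV) (\<lambda>x. ennreal (prob (X -` {x} \<inter> space M)))"
    by (rule measure_eqI_finite[where A = UNIV])
      (use assms in \<open>auto simp: emeasure_distr emeasure_density emeasure_eq_measure
        nn_integral_count_space_finite indicator_def\<close>)
qed (use assms in auto)

text \<open>The sum over y is kept to attained values so that it can be reindexed along a map
  injective only on these.\<close>

lemma (in information_space) mutual_information_count_space_finite:
  fixes X :: "'a \<Rightarrow> 'b::finite" and Y :: "'a \<Rightarrow> 'c::finite"
  assumes X: "random_variable (count_space UNIV) X"
    and Y: "random_variable (count_space UNIV) Y"
  shows "mutual_information b (count_space UNIV) (count_space UNIV) X Y =
    (\<Sum>x\<in>UNIV. \<Sum>y\<in>Y ` space M.
      prob (X -` {x} \<inter> Y -` {y} \<inter> space M) *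
        log b (prob (X -` {x} \<inter> Y -` {y} \<inter> space M) /
          (prob (X -` {x} \<inter> space M) * prob (Y -` {y} \<inter> space M))))"
    (is "_ = (\<Sum>x\<in>UNIV. \<Sum>y\<in>_. ?h x y)")
proof -
  let ?XY = "\<lambda>\<omega>. (X \<omega>, Y \<omega>)"
  have prod: "count_space UNIV \<Otimes>\<^sub>M count_space UNIV = (count_space UNIV :: ('b \<times> 'c) measure)"
    by (simp add: pair_measure_count_space)
  have XY: "random_variable (count_space UNIV) ?XY"
    using measurable_Pair[OF X Y] by (simp add: prod)
  have preimage: "?XY -` {(x, y)} \<inter> space M = X -` {x} \<inter> Y -` {y} \<inter> space M" for x y
    by auto
  have "mutual_information b (count_space UNIV) (count_space UNIV) X Y =
      (\<Sum>z\<in>UNIV. ?h (fst z) (snd z))"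
    \<comment> \<open>The general formula integrates over the product measure, which by
      \<open>prod\<close> is counting measure on a finite type, so the integral is a sum.\<close>
    by (subst mutual_information_distr[OF
          sigma_finite_measure_count_space_finite sigma_finite_measure_count_space_finite
          distributed_count_space_finite[OF X] _ distributed_count_space_finite[OF Y] _
          distributed_count_space_finite[OF XY, folded prod]])
      (auto simp: prod lebesgue_integral_count_space_finite preimage intro!: sum.cong)
  also have "\<dots> = (\<Sum>x\<in>UNIV. \<Sum>y\<in>UNIV. ?h x y)"
    by (simp add: sum.cartesian_product case_prod_beta)
  also have "\<dots> = (\<Sum>x\<in>UNIV. \<Sum>y\<in>Y ` space M. ?h x y)"
  proof (rule sum.cong[OF refl], rule sum.mono_neutral_right, goal_cases)
    case (3 x)
    \<comment> \<open>An unattained y has joint probability 0, and this factor kills the summand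
      whatever the logarithm is.\<close>
    have "X -` {x} \<inter> Y -` {y} \<inter> space M = {}" if "y \<notin> Y ` space M" for y
      using that by auto
    then show ?case
      by simp
  qed auto
  finally show ?thesis .
qed

text \<open>For an attained y, injectivity makes f(Y) = f(y) and Y = y the same event, so all
  marginal and joint probabilities agree.\<close>

lemma (in information_space) mutual_information_inj_finite:
  fixes X :: "'a \<Rightarrow> 'b::finite" and Y :: "'a \<Rightarrow> 'c::finite" and f :: "'c \<Rightarrow> 'd::finite"
  assumes X: "random_variable (count_space UNIV) X"
    and Y: "random_variable (count_space UNIV) Y"
    and inj: "inj_on f (Y ` space M)"
  shows "mutual_information b (count_space UNIV) (count_space UNIV) X (\<lambda>\<omega>. f (Y \<omega>)) =
    mutual_information b (count_space UNIV) (count_space UNIV) X Y"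
proof -
  have fY: "random_variable (count_space UNIV) (\<lambda>\<omega>. f (Y \<omega>))"
    using measurable_compose[OF Y, of f] by simp
  have preimage: "(\<lambda>\<omega>. f (Y \<omega>)) -` {f y} \<inter> space M = Y -` {y} \<inter> space M"
    if "y \<in> Y ` space M" for y
    using that inj by (auto dest: inj_onD)
  then have preimage_Int:
    "A \<inter> (\<lambda>\<omega>. f (Y \<omega>)) -` {f y} \<inter> space M = A \<inter> Y -` {y} \<inter> space M"
    if "y \<in> Y ` space M" for A y
    using that by (simp add: Int_assoc)
  show ?thesis
    unfolding mutual_information_count_space_finite[OF X fY]
      mutual_information_count_space_finite[OF X Y] image_image[of f Y, symmetric]
    by (intro sum.cong refl)
      (simp add: sum.reindex[OF inj] preimage preimage_Int cong: sum.cong)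
qed

theorem theorem1:
  fixes K_E :: "'a::{field,finite}^'m3^'m6"
    and H_E :: "'a^'m5^'m6"
    and \<alpha> :: "'a^'m6 \<Rightarrow> 'a^'m5"
  assumes "uniqueness_condition K_E H_E \<alpha>"
  shows "(\<exists>f g :: 'a^'m6 \<Rightarrow> 'a^'m6.
           \<forall>(M :: 'w measure) X. prob_space M \<longrightarrow> X \<in> M \<rightarrow>\<^sub>M count_space UNIV \<longrightarrow>
             (\<forall>\<omega>\<in>space M.
                Y_E K_E H_E \<alpha> X \<omega> = f (Y_E K_E H_E zero_strategy X \<omega>) \<and>
                Y_E K_E H_E zero_strategy X \<omega> = g (Y_E K_E H_E \<alpha> X \<omega>)))
       \<and> (\<forall>(M :: 'w measure) X b. prob_space M \<longrightarrow> X \<in> M \<rightarrow>\<^sub>M count_space UNIV \<longrightarrow> 1 < b \<longrightarrow>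
             eve_mutual_information M b K_E H_E X zero_strategy
               = eve_mutual_information M b K_E H_E X \<alpha>)"
proof -
  \<comment> \<open>The uniqueness condition controls \<open>f\<close> only on the range of
    \<open>K_E\<close>, which contains every value of the passive observation; injectivity is
    claimed only on such values.\<close>
  define f where "f u = (THE y. y = u + H_E *v \<alpha> y)" for u
  define g where "g y = y - H_E *v \<alpha> y" for y
  have f: "Y_E K_E H_E \<alpha> X \<omega> = f (Y_E K_E H_E zero_strategy X \<omega>)" for X :: "'w \<Rightarrow> _" and \<omega>
    unfolding Y_E_zero f_def by (simp add: Y_E_def)
  have g: "Y_E K_E H_E zero_strategy X \<omega> = g (Y_E K_E H_E \<alpha> X \<omega>)" for X :: "'w \<Rightarrow> _" and \<omega>
    unfolding Y_E_zero g_def using Y_E_fixpoint[OF assms, of X \<omega>] by (simp add: eq_diff_eq)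
  have "eve_mutual_information M b K_E H_E X zero_strategy = eve_mutual_information M b K_E H_E X \<alpha>"
    if "prob_space M" and X: "X \<in> M \<rightarrow>\<^sub>M count_space UNIV" and "1 < b"
    for M :: "'w measure" and X b
  proof -
    interpret information_space M b
      using that by (simp add: information_space_def information_space_axioms_def)
    let ?Y0 = "Y_E K_E H_E zero_strategy X"
    \<comment> \<open>Read backwards, \<open>f\<close> and \<open>g\<close> collapse g(f(Y_E(0))) to
      g(Y_E(\<alpha>)) and then to Y_E(0).\<close>
    have "inj_on f (?Y0 ` space M)"
      by (rule inj_on_inverseI[where g = g]) (auto simp flip: f g)
    moreover have "?Y0 \<in> M \<rightarrow>\<^sub>M count_space UNIV"
      unfolding Y_E_zero using measurable_compose[OF X, of "(*v) K_E"] by simp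
    ultimately show ?thesis
      unfolding eve_mutual_information_def f[abs_def]
      by (intro mutual_information_inj_finite[symmetric] X)
  qed
  with f g show ?thesis
    by blast
qed

end
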